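(* Let $\mathbb{N}_1,\mathbb{N}_2$ be countable infinite sets, $J$ an ideal on $\mathbb{N}_1$ and $K$ an ideal on $\mathbb{N}_2$. Then: (a) if $K\leq_{\mathrm{KB}}J$ then $\mathcal{N}^*_K\subseteq\mathcal{N}^*_J$ and $\mathcal{N}_J\subseteq\mathcal{N}_K$; (b) if $K\leq_{\overline{\mathrm{KB}}}J$ then $\mathcal{N}^*_K\subseteq\mathcal{N}^*_J$ and $\mathcal{N}_J\subseteq\mathcal{N}_K$; (c) if $K\leq_{\mathrm{RB}}J$ then $\mathcal{N}^*_J=\mathcal{N}^*_K$ and $\mathcal{N}_J=\mathcal{N}_K$.
   Context: An ideal on a countable infinite set $W$ is a family $J\subseteq\mathcal{P}(W)$ closed under subsets and finite unions, containing all finite subsets of $W$, with $W\notin J$; $J^+=\mathcal{P}(W)\setminus J$, $J^d=\{W\setminus a:a\in J\}$. ${}^\omega 2$ is the Cantor space with Lebesgue (product) measure $\mu$; $\Omega$ is the set of clopen subsets of ${}^\omega2$. For $\bar c=\langle c_w:w\in W\rangle\in{}^W\Omega$ let $N(\bar c)=\{x:\{w:x\in c_w\}\text{ is infinite}\}$ and $\overline{\Omega}(W)=\{\bar c\in{}^W\Omega:\mu(N(\bar c))=0\}$. For an ideal $J$ on $W$ let $N_J(\bar c)=\{x\in{}^\omega2:\{w:x\in c_w\}\in J^+\}$, $N^*_J(\bar c)=\{x:\{w:x\in c_w\}\in J^d\}$, $\mathcal{N}_J=\{X\subseteq{}^\omega2:\exists\bar c\in\overline{\Omega}(W)\ X\subseteq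 N_J(\bar c)\}$ and $\mathcal{N}^*_J=\{X:\exists\bar c\in\overline{\Omega}(W)\ X\subseteq N^*_J(\bar c)\}$. For $\varphi:M_2\to M_1$ and $K_2\subseteq\mathcal{P}(M_2)$ let $\varphi^{\to}(K_2)=\{A\subseteq M_1:\varphi^{-1}(A)\in K_2\}$. For $K_1\subseteq\mathcal{P}(M_1)$, $K_2\subseteq\mathcal{P}(M_2)$: $K_1\leq_{\mathrm{KB}}K_2$ iff there is a finite-to-one $\varphi:M_2\to M_1$ with $K_1\subseteq\varphi^{\to}(K_2)$; $K_1\leq_{\mathrm{RB}}K_2$ iff there is a finite-to-one $\varphi:M_2\to M_1$ with $K_1=\varphi^{\to}(K_2)$; $K_1\leq_{\overline{\mathrm{KB}}}K_2$ iff there is a finite-to-one $\varphi:M_1\to M_2$ with $\varphi^{\to}(K_1)\subseteq K_2$. *)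

theory Defs
  imports "HOL-Probability.Probability"
begin

definition ideal_on :: "'a set \<Rightarrow> 'a set set \<Rightarrow> bool" where
  "ideal_on W J \<longleftrightarrow>
     J \<subseteq> Pow W \<and>
     (\<forall>A\<in>J. \<forall>B. B \<subseteq> A \<longrightarrow> B \<in> J) \<and>
     (\<forall>A\<in>J. \<forall>B\<in>J. A \<union> B \<in> J) \<and>
     (\<forall>A. A \<subseteq> W \<longrightarrow> finite A \<longrightarrow> A \<in> J) \<and>
     W \<notin> J"

definition positive_sets :: "'a set \<Rightarrow> 'a set set \<Rightarrow> 'a set set" where
  "positive_sets W J = Pow W - J"

definition dual_filter :: "'a set \<Rightarrow> 'a set set \<Rightarrow> 'a set set" where
  "dual_filter W J = {W - a | a. a \<in> J}"

type_synonym cantor = "nat \<Rightarrow> bool"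

text \<open>The topology on \<^typ>\<open>cantor\<close> is the product topology of the type class
  instance for functions, over the discrete two-point space \<^typ>\<open>bool\<close>.\<close>

definition cantor_measure :: "cantor measure" where
  "cantor_measure = (\<Pi>\<^sub>M n\<in>UNIV. measure_pmf (bernoulli_pmf (1/2)))"

definition clopen_sets :: "cantor set set" where
  "clopen_sets = {C. open C \<and> closed C}"

definition N_inf :: "'a set \<Rightarrow> ('a \<Rightarrow> cantor set) \<Rightarrow> cantor set" where
  "N_inf W c = {x. infinite {w\<in>W. x \<in> c w}}"

text \<open>A \<open>W\<close>-indexed sequence is a function on the whole type of which only the values
  on \<open>W\<close> matter.\<close>

definition Omega_bar :: "'a set \<Rightarrow> ('a \<Rightarrow> cantor set) set" where
  "Omega_bar W = {c \<in> W \<rightarrow> clopen_sets. N_inf W c \<in> null_sets cantor_measure}"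

definition N_pos :: "'a set \<Rightarrow> 'a set set \<Rightarrow> ('a \<Rightarrow> cantor set) \<Rightarrow> cantor set" where
  "N_pos W J c = {x. {w\<in>W. x \<in> c w} \<in> positive_sets W J}"

definition N_dual :: "'a set \<Rightarrow> 'a set set \<Rightarrow> ('a \<Rightarrow> cantor set) \<Rightarrow> cantor set" where
  "N_dual W J c = {x. {w\<in>W. x \<in> c w} \<in> dual_filter W J}"

definition null_family :: "'a set \<Rightarrow> 'a set set \<Rightarrow> cantor set set" where
  "null_family W J = {X. \<exists>c\<in>Omega_bar W. X \<subseteq> N_pos W J c}"

definition null_star_family :: "'a set \<Rightarrow> 'a set set \<Rightarrow> cantor set set" where
  "null_star_family W J = {X. \<exists>c\<in>Omega_bar W. X \<subseteq> N_dual W J c}"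

definition finite_to_one :: "'a set \<Rightarrow> 'b set \<Rightarrow> ('a \<Rightarrow> 'b) \<Rightarrow> bool" where
  "finite_to_one A B f \<longleftrightarrow> f \<in> A \<rightarrow> B \<and> (\<forall>y\<in>B. finite {x\<in>A. f x = y})"

definition push_family :: "'b set \<Rightarrow> 'a set \<Rightarrow> ('b \<Rightarrow> 'a) \<Rightarrow> 'b set set \<Rightarrow> 'a set set" where
  "push_family M2 M1 f K2 = {A. A \<subseteq> M1 \<and> f -` A \<inter> M2 \<in> K2}"

definition KB_le :: "'a set \<Rightarrow> 'a set set \<Rightarrow> 'b set \<Rightarrow> 'b set set \<Rightarrow> bool" where
  "KB_le M1 K1 M2 K2 \<longleftrightarrow>
     (\<exists>f. finite_to_one M2 M1 f \<and> K1 \<subseteq> push_family M2 M1 f K2)"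

definition RB_le :: "'a set \<Rightarrow> 'a set set \<Rightarrow> 'b set \<Rightarrow> 'b set set \<Rightarrow> bool" where
  "RB_le M1 K1 M2 K2 \<longleftrightarrow>
     (\<exists>f. finite_to_one M2 M1 f \<and> K1 = push_family M2 M1 f K2)"

text \<open>Here the witness runs in the opposite direction, from \<open>M1\<close> to \<open>M2\<close>.\<close>

definition KB_bar_le :: "'a set \<Rightarrow> 'a set set \<Rightarrow> 'b set \<Rightarrow> 'b set set \<Rightarrow> bool" where
  "KB_bar_le M1 K1 M2 K2 \<longleftrightarrow>
     (\<exists>f. finite_to_one M1 M2 f \<and> push_family M1 M2 f K1 \<subseteq> K2)"

end

theory Submission imports Defs begin

text \<open>
  A finite-to-one map \<open>f\<close> moves a sequence of clopen sets in both directions: backwards by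
  composition, forwards by uniting the sets along each (finite) fibre. For every point \<open>x\<close> the index
  set \<open>{w. x \<in> c w}\<close> is thereby replaced by its preimage, respectively its image, under \<open>f\<close>. Neither
  operation turns a finite index set into an infinite one, so both preserve \<open>Omega_bar\<close>, and each
  inclusion reduces to how \<open>f\<close> transports membership in the ideals. A Rudin-Blass reduction is
  at once a \<open>KB\<close> reduction and a reversed \<open>KB_bar\<close> reduction.
\<close>

lemma open_bool_set: "open (A :: bool set)"
  using finite_imp_closed[of "- A"] by (simp add: open_closed)

text \<open>\<open>sets_PiM_equal_borel\<close> asks for second countable factors. The type is
  finite, so the family of all its subsets is a countable subbase.\<close>

instance bool :: second_countable_topology
proof
  have "open = generate_topology (UNIV :: bool set set)"
    by (simp add: fun_eq_iff open_bool_set generate_topology.Basis)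
  then show "\<exists>B::bool set set. countable B \<and> open = generate_topology B"
    by (blast intro: countable_finite finite)
qed

lemma sets_cantor_measure: "sets cantor_measure = sets borel"
proof -
  have "sets (borel :: bool measure) = UNIV"
    by (auto intro: borel_open open_bool_set)
  then have "sets cantor_measure = sets (\<Pi>\<^sub>M n\<in>(UNIV :: nat set). (borel :: bool measure))"
    unfolding cantor_measure_def by (intro sets_PiM_cong) auto
  then show ?thesis
    by (simp only: sets_PiM_equal_borel)
qed

text \<open>A set of indices is infinite iff no finite \<open>F\<close> covers it. A countable
  \<open>W\<close> has only countably many finite subsets, so \<open>N_inf W c\<close> is a
  countable intersection of open sets.\<close>

lemma N_inf_measurable:
  assumes "countable W" and "c \<in> W \<rightarrow> clopen_sets"
  shows "N_inf W c \<in> sets cantor_measure"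
proof -
  have "N_inf W c = (\<Inter>F\<in>{F. finite F \<and> F \<subseteq> W}. \<Union>w\<in>W - F. c w)"
  proof (intro set_eqI iffI)
    fix x assume "x \<in> N_inf W c"
    then have inf: "infinite {w \<in> W. x \<in> c w}"
      by (simp add: N_inf_def)
    have "\<exists>w\<in>W - F. x \<in> c w" if "finite F" for F
    proof (rule ccontr)
      assume "\<not> (\<exists>w\<in>W - F. x \<in> c w)"
      then have "{w \<in> W. x \<in> c w} \<subseteq> F" by auto
      with that inf show False using finite_subset by blast
    qed
    then show "x \<in> (\<Inter>F\<in>{F. finite F \<and> F \<subseteq> W}. \<Union>w\<in>W - F. c w)" by auto
  next
    fix x assume x: "x \<in> (\<Inter>F\<in>{F. finite F \<and> F \<subseteq> W}. \<Union>w\<in>W - F. c w)"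
    show "x \<in> N_inf W c"
    proof (rule ccontr)
      assume "x \<notin> N_inf W c"
      then have "finite {w \<in> W. x \<in> c w}" by (simp add: N_inf_def)
      \<comment> \<open>The finite index set of \<open>x\<close> itself serves as
        \<open>F\<close>.\<close>
      with x have "x \<in> (\<Union>w\<in>W - {w \<in> W. x \<in> c w}. c w)" by blast
      then show False by blast
    qed
  qed
  moreover have "(\<Inter>F\<in>{F. finite F \<and> F \<subseteq> W}. \<Union>w\<in>W - F. c w) \<in> sets borel"
  proof (intro sets.countable_INT'')
    show "countable {F. finite F \<and> F \<subseteq> W}"
      by (rule countable_Collect_finite_subset[OF assms(1)])
  next
    fix F
    have "open (\<Union>w\<in>W - F. c w)"
      using assms(2) by (intro open_UN) (auto simp: clopen_sets_def)
    then show "(\<Union>w\<in>W - F. c w) \<in> sets borel" by simp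
  qed simp
  ultimately show ?thesis by (simp add: sets_cantor_measure)
qed

text \<open>\<open>cantor_measure\<close> lives on the Borel sets, where a subset of a null set may
  fail to be measurable; \<open>N_inf_measurable\<close> closes this gap, leaving only an inclusion
  to check.\<close>

lemma Omega_barI:
  assumes "countable W" and "c \<in> W \<rightarrow> clopen_sets"
    and "d \<in> Omega_bar V" and "N_inf W c \<subseteq> N_inf V d"
  shows "c \<in> Omega_bar W"
  using assms null_sets_subset[OF _ N_inf_measurable[OF assms(1,2)], of "N_inf V d"]
  by (simp add: Omega_bar_def)

definition fibre_union ::
    "'a set \<Rightarrow> ('a \<Rightarrow> 'b) \<Rightarrow> ('a \<Rightarrow> cantor set) \<Rightarrow> 'b \<Rightarrow> cantor set" where
  "fibre_union W f c v = (\<Union>w\<in>{w \<in> W. f w = v}. c w)"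

lemma index_set_comp:
  assumes "f \<in> W \<rightarrow> V"
  shows "{w \<in> W. x \<in> (c \<circ> f) w} = f -` {v \<in> V. x \<in> c v} \<inter> W"
  using assms by auto

lemma index_set_fibre_union:
  assumes "f \<in> W \<rightarrow> V"
  shows "{v \<in> V. x \<in> fibre_union W f c v} = f ` {w \<in> W. x \<in> c w}"
  using assms by (auto simp: fibre_union_def)

lemma finite_to_one_vimage_finite:
  assumes "finite_to_one W V f" and "finite A" and "A \<subseteq> V"
  shows "finite (f -` A \<inter> W)"
proof -
  have "f -` A \<inter> W = (\<Union>v\<in>A. {w \<in> W. f w = v})" by auto
  with assms show ?thesis by (auto simp: finite_to_one_def)
qed

lemma comp_in_Omega_bar:
  assumes f: "finite_to_one W V f" and "countable W" and c: "c \<in> Omega_bar V"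
  shows "c \<circ> f \<in> Omega_bar W"
proof (rule Omega_barI[OF \<open>countable W\<close> _ c])
  have fWV: "f \<in> W \<rightarrow> V" using f by (simp add: finite_to_one_def)
  then show "c \<circ> f \<in> W \<rightarrow> clopen_sets"
    using c by (auto simp: Omega_bar_def)
  show "N_inf W (c \<circ> f) \<subseteq> N_inf V c"
    using finite_to_one_vimage_finite[OF f]
    unfolding N_inf_def index_set_comp[OF fWV] by blast
qed

text \<open>Finite fibres make each value a finite union of clopen sets, hence clopen. The null
  condition passes on because an infinite image comes only from an infinite index set.\<close>

lemma fibre_union_in_Omega_bar:
  assumes f: "finite_to_one W V f" and "countable V" and c: "c \<in> Omega_bar W"
  shows "fibre_union W f c \<in> Omega_bar V"
proof (rule Omega_barI[OF \<open>countable V\<close> _ c])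
  have fWV: "f \<in> W \<rightarrow> V" using f by (simp add: finite_to_one_def)
  show "fibre_union W f c \<in> V \<rightarrow> clopen_sets"
  proof
    fix v assume "v \<in> V"
    then have "finite {w \<in> W. f w = v}" using f by (simp add: finite_to_one_def)
    moreover have "open (c w)" "closed (c w)" if "w \<in> W" for w
      using c that by (auto simp: Omega_bar_def clopen_sets_def)
    ultimately show "fibre_union W f c v \<in> clopen_sets"
      unfolding fibre_union_def clopen_sets_def by (auto intro!: open_UN closed_UN)
  qed
  show "N_inf V (fibre_union W f c) \<subseteq> N_inf W c"
    unfolding N_inf_def index_set_fibre_union[OF fWV] by blast
qed

text \<open>Members of \<open>J\<close> are subsets of \<open>W\<close>, so complementation in
  \<open>W\<close> is an involution on them.\<close>

lemma in_dual_filter_iff: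
  assumes "ideal_on W J"
  shows "A \<in> dual_filter W J \<longleftrightarrow> A \<subseteq> W \<and> W - A \<in> J"
proof
  assume "A \<in> dual_filter W J"
  then obtain a where "a \<in> J" "A = W - a" by (auto simp: dual_filter_def)
  moreover have "a \<subseteq> W" using \<open>a \<in> J\<close> assms by (auto simp: ideal_on_def)
  ultimately show "A \<subseteq> W \<and> W - A \<in> J" by (simp add: double_diff)
next
  assume "A \<subseteq> W \<and> W - A \<in> J"
  moreover from this have "A = W - (W - A)" by blast
  ultimately show "A \<in> dual_filter W J" unfolding dual_filter_def by blast
qed

lemma ideal_on_subset:
  assumes "ideal_on W J" and "A \<in> J" and "B \<subseteq> A"
  shows "B \<in> J"
  using assms by (auto simp: ideal_on_def)

text \<open>Preimages under \<open>f\<close> send \<open>K\<close> into \<open>J\<close> and commute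
  with complements, so composition handles the dual filters. Positive sets go forward along
  \<open>f\<close> by fibre unions.\<close>

lemma KB_le_imp_null_families:
  assumes "countable W" and "countable V" and J: "ideal_on W J" and K: "ideal_on V K"
    and "KB_le V K W J"
  shows "null_star_family V K \<subseteq> null_star_family W J"
    and "null_family W J \<subseteq> null_family V K"
proof -
  obtain f where f: "finite_to_one W V f" and sub: "K \<subseteq> push_family W V f J"
    using \<open>KB_le V K W J\<close> by (auto simp: KB_le_def)
  have fWV: "f \<in> W \<rightarrow> V" using f by (simp add: finite_to_one_def)
  have pull: "f -` A \<inter> W \<in> J" if "A \<in> K" for A
    using sub that by (auto simp: push_family_def)
  have "N_dual V K c \<subseteq> N_dual W J (c \<circ> f)" for c
  proof
    fix x assume "x \<in> N_dual V K c"
    then have "V - {v \<in> V. x \<in> c v} \<in> K"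
      by (simp add: N_dual_def in_dual_filter_iff[OF K])
    then have "f -` (V - {v \<in> V. x \<in> c v}) \<inter> W \<in> J" by (rule pull)
    moreover have "f -` (V - {v \<in> V. x \<in> c v}) \<inter> W = W - f -` {v \<in> V. x \<in> c v} \<inter> W"
      using fWV by auto
    ultimately show "x \<in> N_dual W J (c \<circ> f)"
      unfolding N_dual_def index_set_comp[OF fWV] by (simp add: in_dual_filter_iff[OF J])
  qed
  then show "null_star_family V K \<subseteq> null_star_family W J"
    using comp_in_Omega_bar[OF f \<open>countable W\<close>] unfolding null_star_family_def by blast
  have "N_pos W J c \<subseteq> N_pos V K (fibre_union W f c)" for c
  proof
    fix x assume "x \<in> N_pos W J c"
    then have "{w \<in> W. x \<in> c w} \<notin> J" by (simp add: N_pos_def positive_sets_def)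
    \<comment> \<open>If the image were in \<open>K\<close>, its preimage would be in
      \<open>J\<close>, and with it the smaller index set.\<close>
    moreover have "{w \<in> W. x \<in> c w} \<subseteq> f -` (f ` {w \<in> W. x \<in> c w}) \<inter> W" by auto
    ultimately have "f ` {w \<in> W. x \<in> c w} \<notin> K"
      using pull ideal_on_subset[OF J] by blast
    then show "x \<in> N_pos V K (fibre_union W f c)"
      using fWV unfolding N_pos_def index_set_fibre_union[OF fWV]
      by (auto simp: positive_sets_def)
  qed
  then show "null_family W J \<subseteq> null_family V K"
    using fibre_union_in_Omega_bar[OF f \<open>countable V\<close>] unfolding null_family_def by blast
qed

text \<open>The witness now runs from \<open>V\<close> to \<open>W\<close>, so the two operations
  swap roles: fibre unions serve the dual filters, composition the positive sets.\<close>

lemma KB_bar_le_imp_null_families: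
  assumes "countable W" and "countable V" and J: "ideal_on W J" and K: "ideal_on V K"
    and "KB_bar_le V K W J"
  shows "null_star_family V K \<subseteq> null_star_family W J"
    and "null_family W J \<subseteq> null_family V K"
proof -
  obtain f where f: "finite_to_one V W f" and sub: "push_family V W f K \<subseteq> J"
    using \<open>KB_bar_le V K W J\<close> by (auto simp: KB_bar_le_def)
  have fVW: "f \<in> V \<rightarrow> W" using f by (simp add: finite_to_one_def)
  have push: "A \<in> J" if "A \<subseteq> W" "f -` A \<inter> V \<in> K" for A
    using sub that by (auto simp: push_family_def)
  have "N_dual V K c \<subseteq> N_dual W J (fibre_union V f c)" for c
  proof
    fix x assume "x \<in> N_dual V K c"
    then have "V - {v \<in> V. x \<in> c v} \<in> K"
      by (simp add: N_dual_def in_dual_filter_iff[OF K])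
    \<comment> \<open>A point sent outside the image of the index set lies outside the index
      set.\<close>
    then have "f -` (W - f ` {v \<in> V. x \<in> c v}) \<inter> V \<in> K"
      by (rule ideal_on_subset[OF K]) auto
    then have "W - f ` {v \<in> V. x \<in> c v} \<in> J" by (intro push) auto
    then show "x \<in> N_dual W J (fibre_union V f c)"
      using fVW unfolding N_dual_def index_set_fibre_union[OF fVW]
      by (auto simp: in_dual_filter_iff[OF J])
  qed
  then show "null_star_family V K \<subseteq> null_star_family W J"
    using fibre_union_in_Omega_bar[OF f \<open>countable W\<close>] unfolding null_star_family_def by blast
  \<comment> \<open>This is the contrapositive of \<open>push\<close>: a set outside
    \<open>J\<close> has its preimage outside \<open>K\<close>.\<close>
  have "N_pos W J c \<subseteq> N_pos V K (c \<circ> f)" for c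
    using push unfolding N_pos_def index_set_comp[OF fVW] by (auto simp: positive_sets_def)
  then show "null_family W J \<subseteq> null_family V K"
    using comp_in_Omega_bar[OF f \<open>countable V\<close>] unfolding null_family_def by blast
qed

lemma RB_le_imp_KB_le: "RB_le V K W J \<Longrightarrow> KB_le V K W J"
  by (auto simp: RB_le_def KB_le_def)

text \<open>The same map is the witness; the equality is read as the inclusion of the pushed family
  in \<open>K\<close>, which swaps the two sides.\<close>

lemma RB_le_imp_KB_bar_le: "RB_le V K W J \<Longrightarrow> KB_bar_le W J V K"
  by (auto simp: RB_le_def KB_bar_le_def)

theorem theorem2p15:
  fixes N1 :: "'a set" and N2 :: "'b set"
    and J :: "'a set set" and K :: "'b set set"
  assumes "countable N1" and "infinite N1"
    and "countable N2" and "infinite N2"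
    and "ideal_on N1 J" and "ideal_on N2 K"
  shows "(KB_le N2 K N1 J \<longrightarrow>
            null_star_family N2 K \<subseteq> null_star_family N1 J \<and>
            null_family N1 J \<subseteq> null_family N2 K) \<and>
         (KB_bar_le N2 K N1 J \<longrightarrow>
            null_star_family N2 K \<subseteq> null_star_family N1 J \<and>
            null_family N1 J \<subseteq> null_family N2 K) \<and>
         (RB_le N2 K N1 J \<longrightarrow>
            null_star_family N1 J = null_star_family N2 K \<and>
            null_family N1 J = null_family N2 K)"
  \<comment> \<open>The instance with both index sets and ideals interchanged yields the reverse
    inclusions of the Rudin-Blass case.\<close>
  using KB_le_imp_null_families[OF assms(1,3,5,6)]
    KB_bar_le_imp_null_families[OF assms(1,3,5,6)]
    KB_bar_le_imp_null_families[OF assms(3,1,6,5)]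
    RB_le_imp_KB_le[of N2 K N1 J] RB_le_imp_KB_bar_le[of N2 K N1 J]
  by (intro conjI impI subset_antisym) simp_all

end
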